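(* Let $K$ be a field of characteristic $0$, and let $\mathcal{A}s_1\langle X\rangle$ be the free first-type associative algebra over $K$ generated by the set $X$. Let $\mathcal{A}s_1^{(-)}\langle X\rangle$ be the same vector space with the commutator operation $[a,b]=ab-ba$. Then all identities of the algebra $\mathcal{A}s_1^{(-)}\langle X\rangle$ up to degree $4$ follow from the anti-commutativity identity $[a,b]=-[b,a]$ and the Jacobi identity $[[a,b],c]+[[b,c],a]+[[c,a],b]=0$.
   Context: A first-type associative algebra is an associative (not necessarily unital) $K$-algebra satisfying the identity $abc+bac+acb+cab+bca+cba=0$; $\mathcal{A}s_1$ is the variety of all such algebras and $\mathcal{A}s_1\langle X\rangle$ is the free algebra of this variety generated by the set $X$. An identity of an algebra with one bilinear operation $[\cdot,\cdot]$ is an element $f$ of the free nonassociative (magmatic) algebra in that operation that vanishes under every substitution of elements of the algebra for the variables. An identity follows from given identities if it lies in the ideal of the free nonassociative algebra, closed under all substitutions (T-ideal), generated by them.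
   Formalization: The generating set X is assumed to have at least two elements; for |X| ≤ 1 the free first-type algebra is commutative, so [a,b]=0 is an identity that does not follow from anti-commutativity and Jacobi, and the claim fails. *)

theory Defs
  imports Complex_Main "HOL-Library.Poly_Mapping"
begin

datatype 'v magma = Var 'v | Node "'v magma" "'v magma"

primrec mon_degree :: "'v magma \<Rightarrow> nat" where
  "mon_degree (Var v) = 1"
| "mon_degree (Node s t) = mon_degree s + mon_degree t"

primrec mon_eval :: "('a \<Rightarrow> 'a \<Rightarrow> 'a) \<Rightarrow> ('v \<Rightarrow> 'a) \<Rightarrow> 'v magma \<Rightarrow> 'a" where
  "mon_eval op \<sigma> (Var v) = \<sigma> v"
| "mon_eval op \<sigma> (Node s t) = op (mon_eval op \<sigma> s) (mon_eval op \<sigma> t)"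

text \<open>The free nonassociative (nonunital) \<open>'k\<close>-algebra on the set of all elements of \<open>'v\<close> is the
  vector space with basis the nonassociative monomials.\<close>

type_synonym ('k, 'v) free_alg = "'v magma \<Rightarrow>\<^sub>0 'k"

definition fvar :: "'v \<Rightarrow> ('k::field, 'v) free_alg" where
  "fvar v = Poly_Mapping.single (Var v) 1"

definition fscale :: "'k::field \<Rightarrow> ('k, 'v) free_alg \<Rightarrow> ('k, 'v) free_alg" where
  "fscale c f = Poly_Mapping.map ((*) c) f"

definition fmult :: "('k::field, 'v) free_alg \<Rightarrow> ('k, 'v) free_alg \<Rightarrow> ('k, 'v) free_alg"
    (infixl "\<odot>" 70) where
  "f \<odot> g = (\<Sum>s\<in>Poly_Mapping.keys f. \<Sum>t\<in>Poly_Mapping.keys g.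
     Poly_Mapping.single (Node s t) (Poly_Mapping.lookup f s * Poly_Mapping.lookup g t))"

definition degree_le :: "nat \<Rightarrow> ('k::field, 'v) free_alg \<Rightarrow> bool" where
  "degree_le n f \<longleftrightarrow> (\<forall>m \<in> Poly_Mapping.keys f. mon_degree m \<le> n)"

definition eval ::
    "('k::field \<Rightarrow> 'a \<Rightarrow> 'a) \<Rightarrow> ('a \<Rightarrow> 'a \<Rightarrow> 'a) \<Rightarrow> ('v \<Rightarrow> 'a) \<Rightarrow> ('k, 'v) free_alg \<Rightarrow> 'a::ab_group_add"
    where
  "eval scale op \<sigma> f =
     (\<Sum>m\<in>Poly_Mapping.keys f. scale (Poly_Mapping.lookup f m) (mon_eval op \<sigma> m))"

text \<open>The operation of the algebra is an explicit argument, so that the same vector space can be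
  considered with different operations. Evaluating in the free algebra itself is substitution.\<close>

definition is_identity ::
    "('k::field \<Rightarrow> 'a \<Rightarrow> 'a) \<Rightarrow> ('a \<Rightarrow> 'a \<Rightarrow> 'a::ab_group_add) \<Rightarrow> ('k, 'v) free_alg \<Rightarrow> bool" where
  "is_identity scale op f \<longleftrightarrow> (\<forall>\<sigma>. eval scale op \<sigma> f = 0)"

definition free_ideal :: "('k::field, 'v) free_alg set \<Rightarrow> bool" where
  "free_ideal I \<longleftrightarrow> 0 \<in> I \<and> (\<forall>f\<in>I. \<forall>g\<in>I. f + g \<in> I) \<and> (\<forall>c. \<forall>f\<in>I. fscale c f \<in> I) \<and>
     (\<forall>f\<in>I. \<forall>g. f \<odot> g \<in> I \<and> g \<odot> f \<in> I)"

definition T_ideal :: "('k::field, 'v) free_alg set \<Rightarrow> bool" where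
  "T_ideal I \<longleftrightarrow> free_ideal I \<and> (\<forall>f\<in>I. \<forall>\<sigma>. eval fscale (\<odot>) \<sigma> f \<in> I)"

definition follows_from :: "('k::field, 'v) free_alg \<Rightarrow> ('k, 'v) free_alg set \<Rightarrow> bool" where
  "follows_from f G \<longleftrightarrow> f \<in> T_ideal hull G"

definition anticomm_identity :: "('k::field, nat) free_alg" where
  "anticomm_identity = (let a = fvar 0; b = fvar 1 in a \<odot> b - (- (b \<odot> a)))"

definition jacobi_identity :: "('k::field, nat) free_alg" where
  "jacobi_identity = (let a = fvar 0; b = fvar 1; c = fvar 2 in
     (a \<odot> b) \<odot> c + (b \<odot> c) \<odot> a + (c \<odot> a) \<odot> b)"

definition assoc_identity :: "('k::field, nat) free_alg" where
  "assoc_identity = (let a = fvar 0; b = fvar 1; c = fvar 2 in (a \<odot> b) \<odot> c - a \<odot> (b \<odot> c))"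

definition first_type_identity :: "('k::field, nat) free_alg" where
  "first_type_identity = (let a = fvar 0; b = fvar 1; c = fvar 2 in
     (a \<odot> b) \<odot> c + (b \<odot> a) \<odot> c + (a \<odot> c) \<odot> b + (c \<odot> a) \<odot> b + (b \<odot> c) \<odot> a + (c \<odot> b) \<odot> a)"

lemma lookup_fscale: "Poly_Mapping.lookup (fscale c f) m = c * Poly_Mapping.lookup f m"
  by (simp add: fscale_def Poly_Mapping.map.rep_eq when_def)

locale bilinear_algebra = vector_space scale
  for scale :: "'k::field \<Rightarrow> 'a::ab_group_add \<Rightarrow> 'a" +
  fixes op :: "'a \<Rightarrow> 'a \<Rightarrow> 'a"
  assumes op_add_left: "op (a + b) c = op a c + op b c"
    and op_add_right: "op a (b + c) = op a b + op a c"
    and op_scale_left: "op (scale r a) b = scale r (op a b)"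
    and op_scale_right: "op a (scale r b) = scale r (op a b)"
begin

lemma op_zero_left [simp]: "op 0 a = 0"
  using op_add_left[of 0 0 a] by simp

lemma op_zero_right [simp]: "op a 0 = 0"
  using op_add_right[of a 0 0] by simp

lemma op_sum_left: "op (sum f A) b = (\<Sum>x\<in>A. op (f x) b)"
  by (induction A rule: infinite_finite_induct) (auto simp: op_add_left)

lemma op_sum_right: "op a (sum f A) = (\<Sum>x\<in>A. op a (f x))"
  by (induction A rule: infinite_finite_induct) (auto simp: op_add_right)

lemma eval_superset:
  assumes "finite A" "Poly_Mapping.keys f \<subseteq> A"
  shows "eval scale op \<sigma> f = (\<Sum>m\<in>A. scale (Poly_Mapping.lookup f m) (mon_eval op \<sigma> m))"
  unfolding eval_def using assms
  by (intro sum.mono_neutral_left) (auto simp: in_keys_iff)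

lemma eval_zero [simp]: "eval scale op \<sigma> 0 = 0"
  by (simp add: eval_def)

lemma eval_add: "eval scale op \<sigma> (f + g) = eval scale op \<sigma> f + eval scale op \<sigma> g"
proof -
  let ?A = "Poly_Mapping.keys f \<union> Poly_Mapping.keys g"
  have "Poly_Mapping.keys (f + g) \<subseteq> ?A" by (rule Poly_Mapping.keys_add)
  then show ?thesis
    by (simp add: eval_superset[of ?A] lookup_add scale_left_distrib sum.distrib)
qed

lemma eval_sum: "eval scale op \<sigma> (sum f A) = (\<Sum>x\<in>A. eval scale op \<sigma> (f x))"
  by (induction A rule: infinite_finite_induct) (auto simp: eval_add)

lemma eval_fscale: "eval scale op \<sigma> (fscale c f) = scale c (eval scale op \<sigma> f)"
proof -
  have "Poly_Mapping.keys (fscale c f) \<subseteq> Poly_Mapping.keys f"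
    by (auto simp: in_keys_iff lookup_fscale)
  then show ?thesis
    by (simp add: eval_superset[of "Poly_Mapping.keys f"] lookup_fscale scale_sum_right)
qed

lemma eval_single: "eval scale op \<sigma> (Poly_Mapping.single m c) = scale c (mon_eval op \<sigma> m)"
  by (simp add: eval_def)

lemma eval_fvar: "eval scale op \<sigma> (fvar v) = \<sigma> v"
  by (simp add: fvar_def eval_single)

lemma eval_fmult: "eval scale op \<sigma> (f \<odot> g) = op (eval scale op \<sigma> f) (eval scale op \<sigma> g)"
proof -
  have "op (eval scale op \<sigma> f) (eval scale op \<sigma> g)
      = (\<Sum>s\<in>Poly_Mapping.keys f. \<Sum>t\<in>Poly_Mapping.keys g.
           scale (Poly_Mapping.lookup f s * Poly_Mapping.lookup g t)
             (op (mon_eval op \<sigma> s) (mon_eval op \<sigma> t)))"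
    by (simp only: eval_def op_sum_left, simp only: op_sum_right op_scale_left op_scale_right
        scale_scale scale_sum_right) (simp only: mult.commute)
  then show ?thesis by (simp add: fmult_def eval_sum eval_single mult.commute)
qed

lemma eval_uminus: "eval scale op \<sigma> (- f) = - eval scale op \<sigma> f"
proof -
  have "eval scale op \<sigma> (- f) + eval scale op \<sigma> f = eval scale op \<sigma> (- f + f)"
    by (simp only: eval_add)
  then show ?thesis by (simp add: eq_neg_iff_add_eq_0)
qed

lemma eval_diff: "eval scale op \<sigma> (f - g) = eval scale op \<sigma> f - eval scale op \<sigma> g"
proof -
  have "eval scale op \<sigma> (f - g) + eval scale op \<sigma> g = eval scale op \<sigma> (f - g + g)"
    by (simp only: eval_add)
  then show ?thesis by (simp add: eq_diff_eq)
qed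

end

lemma fmult_superset:
  assumes "finite A" "Poly_Mapping.keys f \<subseteq> A" "finite B" "Poly_Mapping.keys g \<subseteq> B"
  shows "f \<odot> g = (\<Sum>s\<in>A. \<Sum>t\<in>B.
     Poly_Mapping.single (Node s t) (Poly_Mapping.lookup f s * Poly_Mapping.lookup g t))"
proof -
  have "f \<odot> g = (\<Sum>s\<in>Poly_Mapping.keys f. \<Sum>t\<in>B.
     Poly_Mapping.single (Node s t) (Poly_Mapping.lookup f s * Poly_Mapping.lookup g t))"
    unfolding fmult_def using assms
    by (intro sum.cong refl sum.mono_neutral_left) (auto simp: in_keys_iff)
  also have "\<dots> = (\<Sum>s\<in>A. \<Sum>t\<in>B.
     Poly_Mapping.single (Node s t) (Poly_Mapping.lookup f s * Poly_Mapping.lookup g t))"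
    using assms by (intro sum.mono_neutral_left) (auto simp: in_keys_iff)
  finally show ?thesis .
qed

interpretation free_alg: bilinear_algebra
  "fscale :: 'k::field \<Rightarrow> ('k, 'v) free_alg \<Rightarrow> ('k, 'v) free_alg" "(\<odot>)"
proof
  fix c d :: 'k and f g h :: "('k, 'v) free_alg"
  show "fscale c (f + g) = fscale c f + fscale c g"
    by (rule poly_mapping_eqI) (simp add: lookup_fscale lookup_add algebra_simps)
  show "fscale (c + d) f = fscale c f + fscale d f"
    by (rule poly_mapping_eqI) (simp add: lookup_fscale lookup_add algebra_simps)
  show "fscale c (fscale d f) = fscale (c * d) f"
    by (rule poly_mapping_eqI) (simp add: lookup_fscale)
  show "fscale 1 f = f"
    by (rule poly_mapping_eqI) (simp add: lookup_fscale)
  let ?A = "Poly_Mapping.keys f \<union> Poly_Mapping.keys g"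
    and ?B = "Poly_Mapping.keys g \<union> Poly_Mapping.keys h"
  have sg: "Poly_Mapping.single m (c * x) = fscale c (Poly_Mapping.single m x)" for m :: "'v magma" and c x :: 'k
    by (rule poly_mapping_eqI) (simp add: lookup_fscale lookup_single when_def)
  have fs: "fscale c (p + q) = fscale c p + fscale c q" for p q :: "('k, 'v) free_alg" and c
    by (rule poly_mapping_eqI) (simp add: lookup_fscale lookup_add algebra_simps)
  have f0: "fscale c (0 :: ('k, 'v) free_alg) = 0" for c
    by (rule poly_mapping_eqI) (simp add: lookup_fscale)
  have fsum: "fscale c (sum p S) = (\<Sum>x\<in>S. fscale c (p x))" for p :: "'v magma \<Rightarrow> ('k, 'v) free_alg" and S c
    by (induction S rule: infinite_finite_induct) (auto simp: fs f0)
  have ks: "Poly_Mapping.keys (fscale c p) \<subseteq> Poly_Mapping.keys p" for p :: "('k, 'v) free_alg"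
    by (auto simp: in_keys_iff lookup_fscale)
  have lc: "Poly_Mapping.lookup f s * (c * y) = c * (Poly_Mapping.lookup f s * y)" for s y
    by simp
  have kf: "Poly_Mapping.keys (f + g) \<subseteq> ?A" by (rule Poly_Mapping.keys_add)
  have kg: "Poly_Mapping.keys (g + h) \<subseteq> ?B" by (rule Poly_Mapping.keys_add)
  show "(f + g) \<odot> h = f \<odot> h + g \<odot> h"
    using kf by (simp add: fmult_superset[of ?A _ ?B] lookup_add single_add distrib_right sum.distrib)
  show "f \<odot> (g + h) = f \<odot> g + f \<odot> h"
    using kg by (simp add: fmult_superset[of ?A _ ?B] lookup_add single_add distrib_left sum.distrib)
  show "fscale c f \<odot> g = fscale c (f \<odot> g)"
    by (subst (1 2) fmult_superset[of "Poly_Mapping.keys f" _ "Poly_Mapping.keys g"])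
       (simp_all add: ks lookup_fscale mult.assoc sg fsum)
  show "f \<odot> fscale c g = fscale c (f \<odot> g)"
    by (simp add: fmult_superset[of "Poly_Mapping.keys f" f "Poly_Mapping.keys g"] ks
        lookup_fscale lc sg fsum)
qed

lemma free_ideal_Inter: "(\<And>I. I \<in> \<I> \<Longrightarrow> free_ideal I) \<Longrightarrow> free_ideal (\<Inter>\<I>)"
  unfolding free_ideal_def by (intro conjI ballI allI InterI) (drule (1) InterD | blast)+

lemma free_ideal_hull: "free_ideal (free_ideal hull G)"
  by (rule hull_in, rule free_ideal_Inter) (rule bspec)

lemma T_ideal_hull: "T_ideal (T_ideal hull (G :: ('k::field, 'v) free_alg set))"
proof (rule hull_in)
  fix \<I> :: "('k, 'v) free_alg set set"
  assume *: "Ball \<I> T_ideal"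
  then have "free_ideal (\<Inter>\<I>)" by (intro free_ideal_Inter) (auto simp: T_ideal_def)
  moreover have "eval fscale (\<odot>) \<sigma> f \<in> \<Inter>\<I>" if "f \<in> \<Inter>\<I>" for f \<sigma>
    using * that by (auto simp: T_ideal_def)
  ultimately show "T_ideal (\<Inter>\<I>)" unfolding T_ideal_def by simp
qed

lemma free_ideal_diff: "free_ideal I \<Longrightarrow> f \<in> I \<Longrightarrow> g \<in> I \<Longrightarrow> f - g \<in> I"
proof -
  assume I: "free_ideal I" "f \<in> I" "g \<in> I"
  have "f - g = f + fscale (-1) g"
    by (rule poly_mapping_eqI) (simp add: lookup_fscale lookup_add lookup_minus)
  with I show ?thesis unfolding free_ideal_def by metis
qed

text \<open>The relatively free algebra on the elements of \<open>'x\<close>: the free nonassociative algebra modulo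
  the ideal generated by all values of the two defining identities.\<close>

definition As1_ideal :: "('k::field, 'x) free_alg set" where
  "As1_ideal = free_ideal hull
     {eval fscale (\<odot>) \<sigma> g | \<sigma> g. g \<in> {assoc_identity, first_type_identity}}"

definition As1_rel :: "('k::field, 'x) free_alg \<Rightarrow> ('k, 'x) free_alg \<Rightarrow> bool" where
  "As1_rel f g \<longleftrightarrow> f - g \<in> As1_ideal"

lemma As1_ideal: "free_ideal As1_ideal"
  unfolding As1_ideal_def by (rule free_ideal_hull)

lemma As1_ideal_zero: "0 \<in> As1_ideal"
  and As1_ideal_add: "f \<in> As1_ideal \<Longrightarrow> g \<in> As1_ideal \<Longrightarrow> f + g \<in> As1_ideal"
  and As1_ideal_scale: "f \<in> As1_ideal \<Longrightarrow> fscale c f \<in> As1_ideal"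
  and As1_ideal_left: "f \<in> As1_ideal \<Longrightarrow> f \<odot> g \<in> As1_ideal"
  and As1_ideal_right: "f \<in> As1_ideal \<Longrightarrow> g \<odot> f \<in> As1_ideal"
  using As1_ideal unfolding free_ideal_def by blast+

lemma As1_ideal_diff: "f \<in> As1_ideal \<Longrightarrow> g \<in> As1_ideal \<Longrightarrow> f - g \<in> As1_ideal"
  by (rule free_ideal_diff[OF As1_ideal])

lemma diff_diff_add_swap: "(a - c) - (b - d) = (a - b) - (c - d)" for a :: "'a::ab_group_add"
  by simp

quotient_type (overloaded) ('k, 'x) As1 = "('k::field, 'x) free_alg" / As1_rel
proof (rule equivpI)
  show "reflp As1_rel"
    by (simp add: reflp_def As1_rel_def As1_ideal_zero)
  show "symp As1_rel"
    unfolding symp_def As1_rel_def using As1_ideal_diff[OF As1_ideal_zero] by fastforce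
  show "transp As1_rel"
    unfolding transp_def As1_rel_def using As1_ideal_add by fastforce
qed

instantiation As1 :: (field, type) ring
begin

lift_definition zero_As1 :: "('a, 'b) As1" is 0 .

lift_definition plus_As1 :: "('a, 'b) As1 \<Rightarrow> ('a, 'b) As1 \<Rightarrow> ('a, 'b) As1" is "(+)"
  unfolding As1_rel_def by (subst add_diff_add) (rule As1_ideal_add)

lift_definition minus_As1 :: "('a, 'b) As1 \<Rightarrow> ('a, 'b) As1 \<Rightarrow> ('a, 'b) As1" is "(-)"
  unfolding As1_rel_def by (subst diff_diff_add_swap) (rule As1_ideal_diff)

lift_definition uminus_As1 :: "('a, 'b) As1 \<Rightarrow> ('a, 'b) As1" is uminus
  unfolding As1_rel_def using As1_ideal_diff[OF As1_ideal_zero] by fastforce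

lift_definition times_As1 :: "('a, 'b) As1 \<Rightarrow> ('a, 'b) As1 \<Rightarrow> ('a, 'b) As1" is "(\<odot>)"
proof -
  fix f f' g g' :: "('a, 'b) free_alg"
  assume "As1_rel f f'" "As1_rel g g'"
  then have *: "(f - f') \<odot> g + f' \<odot> (g - g') \<in> As1_ideal"
    unfolding As1_rel_def by (intro As1_ideal_add As1_ideal_left As1_ideal_right)
  have "f \<odot> g = (f - f') \<odot> g + f' \<odot> g"
    using free_alg.op_add_left[of "f - f'" f' g] by simp
  moreover have "f' \<odot> g = f' \<odot> (g - g') + f' \<odot> g'"
    using free_alg.op_add_right[of f' "g - g'" g'] by simp
  ultimately have "f \<odot> g - f' \<odot> g' = (f - f') \<odot> g + f' \<odot> (g - g')"
    by (simp only: add.assoc[symmetric] add_diff_cancel)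
  with * show "As1_rel (f \<odot> g) (f' \<odot> g')" unfolding As1_rel_def by simp
qed

lemma As1_ideal_assoc: "(f \<odot> g) \<odot> h - f \<odot> (g \<odot> h) \<in> As1_ideal"
proof -
  let ?\<sigma> = "\<lambda>i::nat. if i = 0 then f else if i = 1 then g else h"
  have "eval fscale (\<odot>) ?\<sigma> assoc_identity = (f \<odot> g) \<odot> h - f \<odot> (g \<odot> h)"
    by (simp add: assoc_identity_def Let_def free_alg.eval_diff free_alg.eval_fmult free_alg.eval_fvar)
  moreover have "eval fscale (\<odot>) ?\<sigma> assoc_identity \<in> As1_ideal"
    unfolding As1_ideal_def by (rule hull_inc) blast
  ultimately show ?thesis by simp
qed

instance
proof
  fix a b c :: "('a, 'b) As1"
  have eqI: "f = g \<Longrightarrow> As1_rel f g" for f g :: "('a, 'b) free_alg"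
    by (simp add: As1_rel_def As1_ideal_zero)
  show "a + b + c = a + (b + c)" by transfer (rule eqI, simp)
  show "a + b = b + a" by transfer (rule eqI, simp)
  show "0 + a = a" by transfer (rule eqI, simp)
  show "- a + a = 0" by transfer (rule eqI, simp)
  show "a - b = a + - b" by transfer (rule eqI, simp)
  show "a * b * c = a * (b * c)" by transfer (simp add: As1_rel_def As1_ideal_assoc)
  show "(a + b) * c = a * c + b * c" by transfer (rule eqI, rule free_alg.op_add_left)
  show "a * (b + c) = a * b + a * c" by transfer (rule eqI, rule free_alg.op_add_right)
qed

end

lift_definition As1_scale :: "'k::field \<Rightarrow> ('k, 'x) As1 \<Rightarrow> ('k, 'x) As1" is fscale
  unfolding As1_rel_def by (metis As1_ideal_scale free_alg.scale_right_diff_distrib)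

lift_definition As1_gen :: "'x \<Rightarrow> ('k::field, 'x) As1" is fvar .

lemma As1_rel_eqI: "f = g \<Longrightarrow> As1_rel f g"
  by (simp add: As1_rel_def As1_ideal_zero)

interpretation As1: bilinear_algebra
  "As1_scale :: 'k::field \<Rightarrow> ('k, 'x) As1 \<Rightarrow> ('k, 'x) As1" "(*)"
proof
  fix c d :: 'k and a b e :: "('k, 'x) As1"
  show "As1_scale c (a + b) = As1_scale c a + As1_scale c b"
    by transfer (rule As1_rel_eqI, rule free_alg.scale_right_distrib)
  show "As1_scale (c + d) a = As1_scale c a + As1_scale d a"
    by transfer (rule As1_rel_eqI, rule free_alg.scale_left_distrib)
  show "As1_scale c (As1_scale d a) = As1_scale (c * d) a"
    by transfer (rule As1_rel_eqI, simp)
  show "As1_scale 1 a = a"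
    by transfer (rule As1_rel_eqI, simp)
  show "(a + b) * e = a * e + b * e" "a * (b + e) = a * b + a * e"
    by (simp_all add: algebra_simps)
  show "As1_scale c a * b = As1_scale c (a * b)"
    by transfer (rule As1_rel_eqI, rule free_alg.op_scale_left)
  show "a * As1_scale c b = As1_scale c (a * b)"
    by transfer (rule As1_rel_eqI, rule free_alg.op_scale_right)
qed

lemma As1_first_type:
  fixes a b c :: "('k::field, 'x) As1"
  shows "a * b * c + b * a * c + a * c * b + c * a * b + b * c * a + c * b * a = 0"
proof transfer
  fix f g h :: "('k, 'x) free_alg"
  let ?\<sigma> = "\<lambda>i::nat. if i = 0 then f else if i = 1 then g else h"
  have "eval fscale (\<odot>) ?\<sigma> first_type_identity \<in> As1_ideal"
    unfolding As1_ideal_def by (rule hull_inc) blast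
  moreover have "eval fscale (\<odot>) ?\<sigma> first_type_identity
    = f \<odot> g \<odot> h + g \<odot> f \<odot> h + f \<odot> h \<odot> g + h \<odot> f \<odot> g + g \<odot> h \<odot> f + h \<odot> g \<odot> f"
    by (simp add: first_type_identity_def Let_def free_alg.eval_add free_alg.eval_fmult free_alg.eval_fvar)
  ultimately show "As1_rel
      (f \<odot> g \<odot> h + g \<odot> f \<odot> h + f \<odot> h \<odot> g + h \<odot> f \<odot> g + g \<odot> h \<odot> f + h \<odot> g \<odot> f) 0"
    by (simp add: As1_rel_def)
qed

lemma mon_eval_fvar: "mon_eval (\<odot>) fvar m = Poly_Mapping.single m (1::'k::field)"
  by (induction m) (simp_all add: fvar_def fmult_def)

lemma eval_fvar_id: "eval fscale (\<odot>) fvar f = f"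
proof -
  have "eval fscale (\<odot>) fvar f
      = (\<Sum>m\<in>Poly_Mapping.keys f. Poly_Mapping.single m (Poly_Mapping.lookup f m))"
    unfolding eval_def
    by (intro sum.cong refl poly_mapping_eqI)
       (simp add: mon_eval_fvar lookup_fscale lookup_single when_def)
  also have "\<dots> = f"
    by (rule poly_mapping_eqI)
       (auto simp: lookup_sum lookup_single when_def sum.delta in_keys_iff)
  finally show ?thesis .
qed

theorem As1_universal:
  fixes scale :: "'k::field \<Rightarrow> 'b::ring \<Rightarrow> 'b" and \<phi> :: "'x \<Rightarrow> 'b"
  assumes alg: "bilinear_algebra scale (*)"
    and first_type: "\<And>a b c :: 'b. a*b*c + b*a*c + a*c*b + c*a*b + b*c*a + c*b*a = 0"
  shows "\<exists>!h :: ('k, 'x) As1 \<Rightarrow> 'b.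
    (\<forall>a b. h (a + b) = h a + h b) \<and> (\<forall>c a. h (As1_scale c a) = scale c (h a)) \<and>
    (\<forall>a b. h (a * b) = h a * h b) \<and> (\<forall>x. h (As1_gen x) = \<phi> x)"
proof -
  interpret B: bilinear_algebra scale "(*)" by (rule alg)
  let ?E = "eval scale (*) \<phi>"
  have mon: "?E (mon_eval (\<odot>) \<sigma> m) = mon_eval (*) (\<lambda>v. ?E (\<sigma> v)) m" for \<sigma> and m :: "nat magma"
    by (induction m) (simp_all add: B.eval_fmult)
  have subst: "?E (eval fscale (\<odot>) \<sigma> g) = eval scale (*) (\<lambda>v. ?E (\<sigma> v)) g"
    for \<sigma> and g :: "('k, nat) free_alg"
    unfolding eval_def[of fscale] B.eval_sum B.eval_fscale mon by (simp add: eval_def)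
  have ker: "?E f = 0" if "f \<in> As1_ideal" for f
  proof -
    have "free_ideal {f. ?E f = 0}"
      by (auto simp: free_ideal_def B.eval_add B.eval_fscale B.eval_fmult)
    moreover have "{eval fscale (\<odot>) \<sigma> g | \<sigma> g. g \<in> {assoc_identity, first_type_identity}}
        \<subseteq> {f. ?E f = 0}"
      using first_type
      by (auto simp: subst assoc_identity_def first_type_identity_def Let_def B.eval_add B.eval_diff
          B.eval_fmult B.eval_fvar mult.assoc)
    ultimately have "As1_ideal \<subseteq> {f. ?E f = 0}"
      unfolding As1_ideal_def by (intro hull_minimal)
    with that show ?thesis by auto
  qed
  have resp: "?E f = ?E g" if "As1_rel f g" for f g
    using ker[of "f - g"] that by (simp add: As1_rel_def B.eval_diff)
  define h where "h a = ?E (rep_As1 a)" for a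
  have h_abs: "h (abs_As1 f) = ?E f" for f
    unfolding h_def by (rule resp) (rule Quotient_rep_abs[OF Quotient_As1], simp add: As1_rel_eqI)
  have abs_surj: "\<exists>f. a = abs_As1 f" for a :: "('k, 'x) As1"
    by (metis Quotient_abs_rep[OF Quotient_As1])
  show ?thesis
  proof (rule ex1I[of _ h], intro conjI allI)
    fix a b :: "('k, 'x) As1" and c x
    obtain f g where fg: "a = abs_As1 f" "b = abs_As1 g" using abs_surj by blast
    show "h (a + b) = h a + h b" "h (a * b) = h a * h b"
      by (simp_all add: fg plus_As1.abs_eq times_As1.abs_eq h_abs B.eval_add B.eval_fmult)
    show "h (As1_scale c a) = scale c (h a)"
      by (simp add: fg As1_scale.abs_eq h_abs B.eval_fscale)
    show "h (As1_gen x) = \<phi> x"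
      by (simp add: As1_gen.abs_eq h_abs B.eval_fvar)
  next
    fix k :: "('k, 'x) As1 \<Rightarrow> 'b"
    assume k: "(\<forall>a b. k (a + b) = k a + k b) \<and> (\<forall>c a. k (As1_scale c a) = scale c (k a)) \<and>
      (\<forall>a b. k (a * b) = k a * k b) \<and> (\<forall>x. k (As1_gen x) = \<phi> x)"
    have k0: "k 0 = 0" using k by (metis add_cancel_right_right)
    have abs_sum: "abs_As1 (sum p S) = (\<Sum>m\<in>S. abs_As1 (p m))"
      for p :: "'x magma \<Rightarrow> ('k, 'x) free_alg" and S
      by (induction S rule: infinite_finite_induct)
         (simp_all add: zero_As1.abs_eq[symmetric] plus_As1.abs_eq[symmetric])
    have k_sum: "k (sum p S) = (\<Sum>m\<in>S. k (p m))" for p :: "'x magma \<Rightarrow> ('k, 'x) As1" and S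
      by (induction S rule: infinite_finite_induct) (simp_all add: k k0)
    have k_mon: "k (abs_As1 (mon_eval (\<odot>) fvar m)) = mon_eval (*) \<phi> m" for m
      by (induction m) (simp_all add: k As1_gen.abs_eq[symmetric] times_As1.abs_eq[symmetric])
    have k_abs: "k (abs_As1 f) = ?E f" for f
    proof -
      have "k (abs_As1 f) = k (abs_As1 (eval fscale (\<odot>) fvar f))" by (simp add: eval_fvar_id)
      also have "\<dots> = ?E f"
        unfolding eval_def[of fscale]
        by (simp add: abs_sum k_sum As1_scale.abs_eq[symmetric] k k_mon eval_def[of scale])
      finally show ?thesis .
    qed
    show "k = h"
    proof
      fix a show "k a = h a" using abs_surj[of a] by (auto simp: k_abs h_abs)
    qed
  qed
qed

definition commutator :: "'a::ring \<Rightarrow> 'a \<Rightarrow> 'a" where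
  "commutator a b = a * b - b * a"

interpretation As1_minus: bilinear_algebra
  "As1_scale :: 'k::field \<Rightarrow> ('k, 'x) As1 \<Rightarrow> ('k, 'x) As1" commutator
proof
  fix c :: 'k and a b e :: "('k, 'x) As1"
  show "commutator (a + b) e = commutator a e + commutator b e"
    "commutator a (b + e) = commutator a b + commutator a e"
    by (simp_all add: commutator_def distrib_left distrib_right)
  show "commutator (As1_scale c a) b = As1_scale c (commutator a b)"
    "commutator a (As1_scale c b) = As1_scale c (commutator a b)"
    by (simp_all only: commutator_def As1.op_scale_left As1.op_scale_right
        As1.scale_right_diff_distrib)
qed

end

theory Submission
  imports Defs "HOL-Combinatorics.Multiset_Permutations"
begin

text \<open>In characteristic \<open>0\<close> an algebra of the first type is a nil algebra of index three. The free such
  algebra is nilpotent (products of six factors vanish), so identities of high degree are plentiful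
  and the point is that degree at most \<open>4\<close> is too low to see this.

  The field is infinite, so every multihomogeneous part of an identity \<open>f\<close> is again an identity
  (\<open>is_identity_part_leaves\<close>), and it suffices to treat the part whose monomials all have one given
  multiset of variables. Modulo anticommutativity and Jacobi every monomial that contains \<open>w\<close> is a
  combination of left-normed ones \<open>[[[w, x], y], z]\<close> starting with \<open>w\<close>
  (\<open>monomial_in_left_normed_span\<close>). So such a part is a combination of at most six explicit Lie
  monomials, and its coefficients have to be shown to vanish, up to obvious Lie relations, by
  evaluating \<open>f\<close>.

  The generating set is only known to have two elements, so the values are taken in a quotient of the
  free algebra on \<open>a, b\<close>, the type \<open>nil3\<close> of dimension \<open>14\<close>. Its longest nonzero word is \<open>aabab\<close>, of
  degree five, and this is essential: the multilinear Lie polynomials of degree \<open>4\<close> are the sum of the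
  \<open>S\<^sub>4\<close>-modules with Young diagrams \<open>(3,1)\<close> and \<open>(2,1,1)\<close>, and the second one is generated by a
  polynomial alternating in three arguments, hence vanishes on combinations of \<open>a\<close> and \<open>b\<close>. It
  becomes visible only after one of the four arguments is replaced by a product of two generators; a
  typical instance is \<open>[[a, b], [a, ab]] = -3 aabab\<close>. The linear equations obtained from
  substitutions of this kind determine all coefficients (\<open>top4_independent\<close> and its relatives).\<close>

section \<open>Identities of a bilinear algebra\<close>

context bilinear_algebra
begin

lemma eval_mon_eval: "eval scale op \<tau> (mon_eval (\<odot>) \<sigma> m) = mon_eval op (\<lambda>v. eval scale op \<tau> (\<sigma> v)) m"
  by (induction m) (simp_all add: eval_fmult)

lemma eval_eval:
  "eval scale op \<tau> (eval fscale (\<odot>) \<sigma> g) = eval scale op (\<lambda>v. eval scale op \<tau> (\<sigma> v)) g"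
  unfolding eval_def[of fscale] eval_sum eval_fscale eval_mon_eval by (simp add: eval_def)

lemma T_ideal_identities: "T_ideal {f. is_identity scale op f}"
  by (auto simp: T_ideal_def free_ideal_def is_identity_def eval_add eval_fscale eval_fmult eval_eval)

lemma follows_from_is_identity:
  assumes "follows_from f G" "\<And>g. g \<in> G \<Longrightarrow> is_identity scale op g"
  shows "is_identity scale op f"
  using hull_minimal[of G "{f. is_identity scale op f}" T_ideal] T_ideal_identities assms
  by (auto simp: follows_from_def)

end

section \<open>Multihomogeneous parts of identities\<close>

primrec leaves :: "'v magma \<Rightarrow> 'v multiset" where
  "leaves (Var v) = {#v#}"
| "leaves (Node s t) = leaves s + leaves t"

lemma size_leaves: "size (leaves m) = mon_degree m"
  by (induction m) auto

definition part :: "('v magma \<Rightarrow> bool) \<Rightarrow> ('k::field, 'v) free_alg \<Rightarrow> ('k, 'v) free_alg" where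
  "part P f = (\<Sum>m\<in>{m \<in> Poly_Mapping.keys f. P m}. Poly_Mapping.single m (Poly_Mapping.lookup f m))"

lemma lookup_part: "Poly_Mapping.lookup (part P f) m = (if P m then Poly_Mapping.lookup f m else 0)"
  by (auto simp: part_def lookup_sum lookup_single when_def sum.delta in_keys_iff)

lemma part_part: "part P (part Q f) = part (\<lambda>m. P m \<and> Q m) f"
  by (rule poly_mapping_eqI) (simp add: lookup_part)

lemma part_cong: "(\<And>m. m \<in> Poly_Mapping.keys f \<Longrightarrow> P m = Q m) \<Longrightarrow> part P f = part Q f"
  by (rule poly_mapping_eqI) (auto simp: lookup_part in_keys_iff)

lemma sum_part_leaves:
  "(\<Sum>N\<in>leaves ` Poly_Mapping.keys f. part (\<lambda>m. leaves m = N) f) = f"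
proof (rule poly_mapping_eqI)
  fix m
  have "Poly_Mapping.lookup (\<Sum>N\<in>leaves ` Poly_Mapping.keys f. part (\<lambda>m. leaves m = N) f) m
      = (\<Sum>N\<in>leaves ` Poly_Mapping.keys f. if leaves m = N then Poly_Mapping.lookup f m else 0)"
    by (simp add: lookup_sum lookup_part)
  also have "\<dots> = Poly_Mapping.lookup f m"
    by (auto simp: sum.delta' in_keys_iff)
  finally show "Poly_Mapping.lookup (\<Sum>N\<in>leaves ` Poly_Mapping.keys f. part (\<lambda>m. leaves m = N) f) m
      = Poly_Mapping.lookup f m" .
qed

text \<open>A vector-valued polynomial function that vanishes everywhere has zero coefficients. The proof
  compares the values at \<open>t\<close> and \<open>2 * t\<close>, which eliminates the leading coefficient and multiplies the
  lower ones by nonzero scalars; this avoids Vandermonde determinants.\<close>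

lemma polynomial_zero_coeffs:
  fixes scale :: "'k::field_char_0 \<Rightarrow> 'a::ab_group_add \<Rightarrow> 'a"
  assumes vs: "vector_space scale"
    and zero: "\<And>t. (\<Sum>k\<le>n. scale (t ^ k) (a k)) = 0" and "k \<le> n"
  shows "a k = 0"
proof -
  interpret vector_space scale by (rule vs)
  show ?thesis using zero \<open>k \<le> n\<close>
  proof (induction n arbitrary: a k)
    case 0
    then show ?case using "0.prems"(1)[of 1] by simp
  next
    case (Suc n)
    \<comment> \<open>The combination \<open>p (2 * t) - 2 ^ Suc n * p t\<close> has no term of degree \<open>Suc n\<close>.\<close>
    have lower: "a i = 0" if "i \<le> n" for i
    proof -
      have "(\<Sum>k\<le>n. scale (t ^ k) (scale (2 ^ k - 2 ^ Suc n) (a k))) = 0" for t :: 'k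
      proof -
        have "(\<Sum>k\<le>n. scale (t ^ k) (scale (2 ^ k - 2 ^ Suc n) (a k)))
            = (\<Sum>k\<le>Suc n. scale (t ^ k) (scale (2 ^ k - 2 ^ Suc n) (a k)))"
          by simp
        also have "\<dots> = (\<Sum>k\<le>Suc n. scale ((2 * t) ^ k) (a k) - scale (2 ^ Suc n) (scale (t ^ k) (a k)))"
          by (intro sum.cong refl)
             (simp add: scale_left_diff_distrib scale_right_diff_distrib power_mult_distrib right_diff_distrib mult.commute)
        also have "\<dots> = 0"
          by (simp only: sum_subtractf scale_sum_right[symmetric] Suc.prems(1)) simp
        finally show ?thesis .
      qed
      then have "scale (2 ^ i - 2 ^ Suc n) (a i) = 0" using that by (rule Suc.IH)
      moreover have "(2 :: 'k) ^ i \<noteq> 2 ^ Suc n"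
      proof -
        have "(of_nat (2 ^ i) :: 'k) \<noteq> of_nat (2 ^ Suc n)"
          using that by (subst of_nat_eq_iff) (simp add: power_inject_exp del: power_Suc)
        then show ?thesis by simp
      qed
      ultimately show ?thesis by simp
    qed
    then show ?case using Suc.prems(1)[of 1] Suc.prems(2) by (cases "k = Suc n") auto
  qed
qed

lemma (in bilinear_algebra) mon_eval_rescale:
  "mon_eval op (\<sigma>(v := scale t (\<sigma> v))) m = scale (t ^ count (leaves m) v) (mon_eval op \<sigma> m)"
  by (induction m) (simp_all add: op_scale_left op_scale_right power_add mult.commute)

text \<open>Multiplying the value of one variable \<open>v\<close> by \<open>t\<close> turns the value of \<open>f\<close> into a polynomial in \<open>t\<close>, whose
  coefficients are the values of the parts of fixed degree in \<open>v\<close>.\<close>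

lemma is_identity_part_count:
  fixes scale :: "'k::field_char_0 \<Rightarrow> 'a::ab_group_add \<Rightarrow> 'a"
  assumes alg: "bilinear_algebra scale op" and f: "is_identity scale op f"
  shows "is_identity scale op (part (\<lambda>m. count (leaves m) v = k) f)"
proof -
  interpret bilinear_algebra scale op by (rule alg)
  let ?c = "\<lambda>m. count (leaves m) v"
  let ?K = "Poly_Mapping.keys f"
  define n where "n = Max (insert k (?c ` ?K))"
  have n: "k \<le> n" "?c ` ?K \<subseteq> {..n}"
    by (auto simp: n_def)
  have "eval scale op \<sigma> (part (\<lambda>m. ?c m = k) f) = 0" for \<sigma>
  proof (rule polynomial_zero_coeffs[where a = "\<lambda>i. eval scale op \<sigma> (part (\<lambda>m. ?c m = i) f)"])
    fix t :: 'k
    have "(\<Sum>i\<le>n. scale (t ^ i) (eval scale op \<sigma> (part (\<lambda>m. ?c m = i) f)))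
        = (\<Sum>i\<le>n. \<Sum>m\<in>{m \<in> ?K. ?c m = i}.
             scale (Poly_Mapping.lookup f m) (mon_eval op (\<sigma>(v := scale t (\<sigma> v))) m))"
      by (simp add: part_def eval_sum eval_single scale_sum_right mon_eval_rescale mult.commute)
    also have "\<dots> = eval scale op (\<sigma>(v := scale t (\<sigma> v))) f"
      unfolding eval_def by (rule sum.group) (use n in auto)
    also have "\<dots> = 0" using f by (simp add: is_identity_def)
    finally show "(\<Sum>i\<le>n. scale (t ^ i) (eval scale op \<sigma> (part (\<lambda>m. ?c m = i) f))) = 0" .
  qed (use n vector_space_axioms in auto)
  then show ?thesis by (simp add: is_identity_def)
qed

text \<open>Separating one variable after the other leaves the monomials with a prescribed multiset of
  variables. Only the variables of \<open>f\<close> and of \<open>N\<close> matter, so finitely many steps suffice.\<close>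

lemma is_identity_part_leaves:
  fixes scale :: "'k::field_char_0 \<Rightarrow> 'a::ab_group_add \<Rightarrow> 'a"
  assumes alg: "bilinear_algebra scale op" and f: "is_identity scale op f"
  shows "is_identity scale op (part (\<lambda>m. leaves m = N) f)"
proof -
  have *: "is_identity scale op (part (\<lambda>m. \<forall>v\<in>V. count (leaves m) v = count N v) f)"
    if "finite V" for V
    using that
  proof (induction V)
    case empty
    have "part (\<lambda>m. True) f = f" by (rule poly_mapping_eqI) (simp add: lookup_part)
    then show ?case using f by simp
  next
    case (insert v V)
    have "part (\<lambda>m. \<forall>v\<in>insert v V. count (leaves m) v = count N v) f
        = part (\<lambda>m. count (leaves m) v = count N v)
            (part (\<lambda>m. \<forall>v\<in>V. count (leaves m) v = count N v) f)"
      by (simp add: part_part)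
    then show ?case using is_identity_part_count[OF alg insert.IH] by simp
  qed
  let ?V = "set_mset N \<union> (\<Union>m\<in>Poly_Mapping.keys f. set_mset (leaves m))"
  have "part (\<lambda>m. \<forall>v\<in>?V. count (leaves m) v = count N v) f = part (\<lambda>m. leaves m = N) f"
  proof (rule part_cong)
    fix m assume m: "m \<in> Poly_Mapping.keys f"
    show "(\<forall>v\<in>?V. count (leaves m) v = count N v) = (leaves m = N)"
    proof
      assume H: "\<forall>v\<in>?V. count (leaves m) v = count N v"
      show "leaves m = N"
      proof (rule multiset_eqI)
        fix v
        show "count (leaves m) v = count N v"
        proof (cases "v \<in> ?V")
          case False
          then have "v \<notin># leaves m" "v \<notin># N" using m by auto
          then show ?thesis by (simp add: not_in_iff)
        qed (use H in blast)
      qed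
    qed simp
  qed
  then show ?thesis using *[of ?V] by simp
qed

section \<open>Left-normed monomials modulo anticommutativity and Jacobi\<close>

definition Lie_ideal :: "('k::field, nat) free_alg set" where
  "Lie_ideal = T_ideal hull {anticomm_identity, jacobi_identity}"

lemma free_ideal_Lie_ideal: "free_ideal Lie_ideal"
  and eval_Lie_ideal: "f \<in> Lie_ideal \<Longrightarrow> eval fscale (\<odot>) \<sigma> f \<in> Lie_ideal"
  using T_ideal_hull[of "{anticomm_identity, jacobi_identity}"]
  by (auto simp: Lie_ideal_def T_ideal_def)

lemma Lie_ideal_zero: "0 \<in> Lie_ideal"
  and Lie_ideal_add: "f \<in> Lie_ideal \<Longrightarrow> g \<in> Lie_ideal \<Longrightarrow> f + g \<in> Lie_ideal"
  and Lie_ideal_scale: "f \<in> Lie_ideal \<Longrightarrow> fscale c f \<in> Lie_ideal"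
  and Lie_ideal_left: "f \<in> Lie_ideal \<Longrightarrow> f \<odot> g \<in> Lie_ideal"
  using free_ideal_Lie_ideal unfolding free_ideal_def by blast+

lemma Lie_ideal_diff: "f \<in> Lie_ideal \<Longrightarrow> g \<in> Lie_ideal \<Longrightarrow> f - g \<in> Lie_ideal"
  by (rule free_ideal_diff[OF free_ideal_Lie_ideal])

lemma Lie_ideal_sum: "(\<And>x. x \<in> A \<Longrightarrow> F x \<in> Lie_ideal) \<Longrightarrow> sum F A \<in> Lie_ideal"
  by (induction A rule: infinite_finite_induct) (auto intro: Lie_ideal_zero Lie_ideal_add)

lemma subspace_Lie_ideal: "free_alg.subspace Lie_ideal"
  by (simp add: free_alg.subspace_def Lie_ideal_zero Lie_ideal_add Lie_ideal_scale)

lemma anticomm_in_Lie_ideal: "f \<odot> g + g \<odot> f \<in> Lie_ideal"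
proof -
  have "eval fscale (\<odot>) (\<lambda>i. if i = 0 then f else g) anticomm_identity \<in> Lie_ideal"
    by (intro eval_Lie_ideal) (simp add: Lie_ideal_def hull_inc)
  then show ?thesis
    by (simp add: anticomm_identity_def Let_def free_alg.eval_add
        free_alg.eval_fmult free_alg.eval_fvar)
qed

lemma jacobi_in_Lie_ideal: "(f \<odot> g) \<odot> h + (g \<odot> h) \<odot> f + (h \<odot> f) \<odot> g \<in> Lie_ideal"
proof -
  have "eval fscale (\<odot>) (\<lambda>i. if i = 0 then f else if i = 1 then g else h) jacobi_identity \<in> Lie_ideal"
    by (intro eval_Lie_ideal) (simp add: Lie_ideal_def hull_inc)
  then show ?thesis
    by (simp add: jacobi_identity_def Let_def free_alg.eval_add free_alg.eval_fmult free_alg.eval_fvar)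
qed

lemma square_in_Lie_ideal: "f \<odot> f \<in> Lie_ideal" for f :: "('k::field_char_0, nat) free_alg"
proof -
  have "fscale (1/2) (f \<odot> f + f \<odot> f) = f \<odot> f"
    by (rule poly_mapping_eqI) (simp add: lookup_fscale lookup_add)
  then show ?thesis using Lie_ideal_scale[OF anticomm_in_Lie_ideal[of f f], of "1/2"] by simp
qed

text \<open>The Jacobi identity in the form that moves a product in the right factor to the left.\<close>

lemma derivation_in_Lie_ideal: "f \<odot> (g \<odot> h) - ((f \<odot> g) \<odot> h - (f \<odot> h) \<odot> g) \<in> Lie_ideal"
proof -
  have "f \<odot> (g \<odot> h) - ((f \<odot> g) \<odot> h - (f \<odot> h) \<odot> g)
      = (f \<odot> (g \<odot> h) + (g \<odot> h) \<odot> f) + (f \<odot> h + h \<odot> f) \<odot> g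
        - ((f \<odot> g) \<odot> h + (g \<odot> h) \<odot> f + (h \<odot> f) \<odot> g)"
    by (simp add: free_alg.op_add_left algebra_simps)
  then show ?thesis
    using Lie_ideal_diff[OF Lie_ideal_add[OF anticomm_in_Lie_ideal[of f "g \<odot> h"]
        Lie_ideal_left[OF anticomm_in_Lie_ideal[of f h], of g]] jacobi_in_Lie_ideal[of f g h]]
    by (simp only:)
qed

definition left_normed :: "nat \<Rightarrow> nat list \<Rightarrow> ('k::field, nat) free_alg" where
  "left_normed w xs = foldl (\<lambda>f x. f \<odot> fvar x) (fvar w) xs"

text \<open>The ideal is added to the spanning set, so that membership means being congruent to a combination
  of left-normed monomials.\<close>

definition left_normed_span :: "nat \<Rightarrow> nat multiset \<Rightarrow> ('k::field, nat) free_alg set" where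
  "left_normed_span w M = free_alg.span (left_normed w ` permutations_of_multiset M \<union> Lie_ideal)"

lemma left_normed_span_add:
    "f \<in> left_normed_span w M \<Longrightarrow> g \<in> left_normed_span w M \<Longrightarrow> f + g \<in> left_normed_span w M"
  and left_normed_span_diff:
    "f \<in> left_normed_span w M \<Longrightarrow> g \<in> left_normed_span w M \<Longrightarrow> f - g \<in> left_normed_span w M"
  and left_normed_span_Lie_ideal: "f \<in> Lie_ideal \<Longrightarrow> f \<in> left_normed_span w M"
  by (auto simp: left_normed_span_def intro: free_alg.span_add free_alg.span_diff free_alg.span_base)

text \<open>Right multiplication by a monomial \<open>t\<close> is reduced to right multiplications by its variables: modulo
  the ideal, multiplication by \<open>s \<odot> t\<close> is the commutator of the multiplications by \<open>s\<close> and by \<open>t\<close>.\<close>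

lemma left_normed_span_times_monomial:
  "f \<in> left_normed_span w M \<Longrightarrow> f \<odot> mon_eval (\<odot>) fvar t \<in> left_normed_span w (M + leaves t)"
proof (induction t arbitrary: f M)
  case (Var v)
  have "left_normed_span w M \<subseteq> {f. f \<odot> fvar v \<in> left_normed_span w (M + {#v#})}"
    unfolding left_normed_span_def[of w M]
  proof (rule free_alg.span_minimal)
    show "left_normed w ` permutations_of_multiset M \<union> Lie_ideal
        \<subseteq> {f. f \<odot> fvar v \<in> left_normed_span w (M + {#v#})}"
    proof safe
      fix xs assume "xs \<in> permutations_of_multiset M"
      then have "M = mset xs" by (simp add: permutations_of_multisetD)
      then have "left_normed w (xs @ [v]) \<in> left_normed_span w (M + {#v#})"
        unfolding left_normed_span_def
        by (intro free_alg.span_base) (auto simp: permutations_of_multiset_def)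
      then show "left_normed w xs \<odot> fvar v \<in> left_normed_span w (M + {#v#})"
        by (simp add: left_normed_def)
    qed (auto intro: left_normed_span_Lie_ideal Lie_ideal_left)
    show "free_alg.subspace {f. f \<odot> fvar v \<in> left_normed_span w (M + {#v#})}"
      by (auto simp: free_alg.subspace_def free_alg.op_add_left free_alg.op_scale_left
          left_normed_span_def free_alg.span_zero intro: free_alg.span_add free_alg.span_scale)
  qed
  then show ?case using Var.prems by auto
next
  case (Node s t)
  let ?s = "mon_eval (\<odot>) fvar s" and ?t = "mon_eval (\<odot>) fvar t"
  let ?S = "left_normed_span w (M + leaves (Node s t))"
  have "(f \<odot> ?s) \<odot> ?t \<in> ?S"
    using Node.IH(2)[OF Node.IH(1)[OF Node.prems]] by (simp add: add_ac)
  moreover have "(f \<odot> ?t) \<odot> ?s \<in> ?S"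
    using Node.IH(1)[OF Node.IH(2)[OF Node.prems]] by (simp add: add_ac)
  ultimately have "f \<odot> (?s \<odot> ?t) - ((f \<odot> ?s) \<odot> ?t - (f \<odot> ?t) \<odot> ?s)
      + ((f \<odot> ?s) \<odot> ?t - (f \<odot> ?t) \<odot> ?s) \<in> ?S"
    by (rule left_normed_span_add[OF left_normed_span_Lie_ideal[OF derivation_in_Lie_ideal]
          left_normed_span_diff])
  then show ?case by simp
qed

text \<open>Any variable of the monomial can be brought to the front: anticommutativity puts the factor that
  contains \<open>w\<close> on the left, and the other factor is then multiplied in.\<close>

lemma monomial_in_left_normed_span:
  "w \<in># leaves m \<Longrightarrow>
    (mon_eval (\<odot>) fvar m :: ('k::field, nat) free_alg) \<in> left_normed_span w (leaves m - {#w#})"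
proof (induction m)
  case (Var v)
  have "left_normed w [] \<in> left_normed_span w {#}"
    unfolding left_normed_span_def by (intro free_alg.span_base) auto
  then show ?case using Var by (simp add: left_normed_def)
next
  case (Node s t)
  let ?s = "mon_eval (\<odot>) fvar s :: ('k, nat) free_alg"
    and ?t = "mon_eval (\<odot>) fvar t :: ('k, nat) free_alg"
  show ?case
  proof (cases "w \<in># leaves s")
    case True
    then show ?thesis
      using left_normed_span_times_monomial[OF Node.IH(1)[OF True], of t] by simp
  next
    case False
    then have t: "w \<in># leaves t" using Node.prems by simp
    then have "?t \<odot> ?s \<in> left_normed_span w (leaves s + leaves t - {#w#})"
      using left_normed_span_times_monomial[OF Node.IH(2)[OF t], of s] by (simp add: add.commute)
    then have "(?s \<odot> ?t + ?t \<odot> ?s) - ?t \<odot> ?s \<in> left_normed_span w (leaves s + leaves t - {#w#})"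
      by (rule left_normed_span_diff[OF left_normed_span_Lie_ideal[OF anticomm_in_Lie_ideal]])
    then show ?thesis by simp
  qed
qed

lemma part_in_left_normed_span: "part (\<lambda>m. leaves m = add_mset w M) f \<in> left_normed_span w M"
proof -
  have "fscale c (mon_eval (\<odot>) fvar m) = Poly_Mapping.single m c" for m :: "nat magma" and c :: 'a
    by (rule poly_mapping_eqI) (simp add: mon_eval_fvar lookup_fscale lookup_single when_def)
  then have "Poly_Mapping.single m c \<in> left_normed_span w M"
    if "leaves m = add_mset w M" for m and c :: 'a
    using monomial_in_left_normed_span[of w m] that
    by (metis add_mset_remove_trivial free_alg.span_scale left_normed_span_def union_single_eq_member)
  then show ?thesis
    unfolding part_def left_normed_span_def by (intro free_alg.span_sum) auto
qed

lemma left_normed_span_combination: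
  assumes "f \<in> left_normed_span w M"
  obtains c where "f - (\<Sum>xs\<in>permutations_of_multiset M. fscale (c xs) (left_normed w xs)) \<in> Lie_ideal"
proof -
  have "\<exists>c. f - (\<Sum>xs\<in>S. fscale (c xs) (left_normed w xs)) \<in> Lie_ideal"
    if "finite S" "f \<in> free_alg.span (left_normed w ` S \<union> Lie_ideal)" for S
    using that
  proof (induction S arbitrary: f)
    case empty
    then show ?case by (simp add: free_alg.span_eq_iff[THEN iffD2, OF subspace_Lie_ideal])
  next
    case (insert ys S)
    from insert.prems obtain k where
      "f - fscale k (left_normed w ys) \<in> free_alg.span (left_normed w ` S \<union> Lie_ideal)"
      by (auto simp: free_alg.span_insert)
    from insert.IH[OF this] obtain c where
      c: "f - fscale k (left_normed w ys) - (\<Sum>xs\<in>S. fscale (c xs) (left_normed w xs)) \<in> Lie_ideal"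
      by blast
    have "(\<Sum>xs\<in>S. fscale ((c(ys := k)) xs) (left_normed w xs))
        = (\<Sum>xs\<in>S. fscale (c xs) (left_normed w xs))"
      using insert.hyps by (intro sum.cong) auto
    then have "f - (\<Sum>xs\<in>insert ys S. fscale ((c(ys := k)) xs) (left_normed w xs)) \<in> Lie_ideal"
      using c insert.hyps by (simp add: diff_diff_eq)
    then show ?case by blast
  qed
  from this[OF finite_permutations_of_multiset, folded left_normed_span_def, OF assms] that
  show ?thesis by blast
qed

lemma left_normed_self_in_Lie_ideal: "left_normed w (w # xs) \<in> (Lie_ideal :: ('k::field_char_0, nat) free_alg set)"
proof -
  have "foldl (\<lambda>f x. f \<odot> fvar x) g xs \<in> Lie_ideal"
    if "g \<in> Lie_ideal" for g :: "('k, nat) free_alg"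
    using that by (induction xs arbitrary: g) (simp_all add: Lie_ideal_left)
  then show ?thesis
    by (simp add: left_normed_def square_in_Lie_ideal)
qed

text \<open>With \<open>u = [w, x]\<close> this is \<open>[[u, w], x] - [[u, x], w] = [u, [w, x]] = [u, u] = 0\<close>.\<close>

lemma left_normed_swap_last:
  "left_normed w [x, w, x] - left_normed w [x, x, w] \<in> (Lie_ideal :: ('k::field_char_0, nat) free_alg set)"
proof -
  let ?u = "fvar w \<odot> fvar x :: ('k, nat) free_alg"
  have "?u \<odot> ?u - (?u \<odot> ?u - (?u \<odot> fvar w \<odot> fvar x - ?u \<odot> fvar x \<odot> fvar w)) \<in> Lie_ideal"
    by (rule Lie_ideal_diff[OF square_in_Lie_ideal derivation_in_Lie_ideal])
  then show ?thesis by (simp add: left_normed_def)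
qed

section \<open>A two-generated nil algebra of index three\<close>

text \<open>In characteristic \<open>0\<close> this is the free algebra of the first type on \<open>a\<close> and \<open>b\<close>, modulo all words
  with at least three letters \<open>b\<close>.
  The fields are the coordinates with respect to a basis of words. The multiplication below is
  concatenation of words followed by rewriting with the consequences of the defining identity, for
  instance \<open>aaa = 0\<close>, \<open>baa = - aab - aba\<close> and \<open>abba = - aabb - abab\<close>.\<close>

datatype 'k nil3 = Nil3
  (c_a: 'k) (c_b: 'k) (c_aa: 'k) (c_ab: 'k) (c_ba: 'k) (c_bb: 'k) (c_aab: 'k) (c_aba: 'k)
  (c_abb: 'k) (c_bab: 'k) (c_aaba: 'k) (c_aabb: 'k) (c_abab: 'k) (c_aabab: 'k)

instantiation nil3 :: (field) ring
begin

definition zero_nil3 :: "'a nil3" where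
  "0 = Nil3 0 0 0 0 0 0 0 0 0 0 0 0 0 0"

definition plus_nil3 :: "'a nil3 \<Rightarrow> 'a nil3 \<Rightarrow> 'a nil3" where
  "x + y =
    Nil3 (c_a x + c_a y) (c_b x + c_b y) (c_aa x + c_aa y) (c_ab x + c_ab y) (c_ba x + c_ba y)
      (c_bb x + c_bb y) (c_aab x + c_aab y) (c_aba x + c_aba y) (c_abb x + c_abb y)
      (c_bab x + c_bab y) (c_aaba x + c_aaba y) (c_aabb x + c_aabb y) (c_abab x + c_abab y)
      (c_aabab x + c_aabab y)"

definition minus_nil3 :: "'a nil3 \<Rightarrow> 'a nil3 \<Rightarrow> 'a nil3" where
  "x - y =
    Nil3 (c_a x - c_a y) (c_b x - c_b y) (c_aa x - c_aa y) (c_ab x - c_ab y) (c_ba x - c_ba y)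
      (c_bb x - c_bb y) (c_aab x - c_aab y) (c_aba x - c_aba y) (c_abb x - c_abb y)
      (c_bab x - c_bab y) (c_aaba x - c_aaba y) (c_aabb x - c_aabb y) (c_abab x - c_abab y)
      (c_aabab x - c_aabab y)"

definition uminus_nil3 :: "'a nil3 \<Rightarrow> 'a nil3" where
  "- x =
    Nil3 (- c_a x) (- c_b x) (- c_aa x) (- c_ab x) (- c_ba x) (- c_bb x) (- c_aab x) (- c_aba x)
      (- c_abb x) (- c_bab x) (- c_aaba x) (- c_aabb x) (- c_abab x) (- c_aabab x)"

definition times_nil3 :: "'a nil3 \<Rightarrow> 'a nil3 \<Rightarrow> 'a nil3" where
  "x * y = Nil3
    (0)
    (0)
    (c_a x * c_a y)
    (c_a x * c_b y)
    (c_b x * c_a y)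
    (c_b x * c_b y)
    (c_a x * c_ab y - c_b x * c_aa y + c_aa x * c_b y - c_ba x * c_a y)
    (c_a x * c_ba y - c_b x * c_aa y + c_ab x * c_a y - c_ba x * c_a y)
    (c_a x * c_bb y - c_b x * c_ba y + c_ab x * c_b y - c_bb x * c_a y)
    (c_b x * c_ab y - c_b x * c_ba y + c_ba x * c_b y - c_bb x * c_a y)
    (c_a x * c_aba y + c_aa x * c_ba y - c_ab x * c_aa y + c_aab x * c_a y - c_aba x * c_a y)
    (c_a x * c_abb y - c_b x * c_aab y + c_b x * c_aba y + c_aa x * c_bb y - c_ab x * c_ba y -
     c_ba x * c_ab y + c_ba x * c_ba y + c_aab x * c_b y - c_abb x * c_a y + c_bab x * c_a y)
    (c_a x * c_bab y - c_b x * c_aab y + c_ab x * c_ab y - c_ab x * c_ba y - c_ba x * c_ab y +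
     c_bb x * c_aa y + c_aba x * c_b y - c_abb x * c_a y)
    (c_a x * c_abab y + c_b x * c_aaba y + c_aa x * c_bab y - c_ab x * c_aab y + c_ba x * c_aba y +
     c_aab x * c_ab y - c_aab x * c_ba y - c_aba x * c_ab y + c_abb x * c_aa y -
     c_bab x * c_aa y + c_aaba x * c_b y - c_aabb x * c_a y)"

instance
proof
  fix x y z :: "'a nil3"
  show "x + y + z = x + (y + z)" "x + y = y + x" "0 + x = x" "- x + x = 0" "x - y = x + - y"
    by (simp_all add: plus_nil3_def minus_nil3_def uminus_nil3_def zero_nil3_def)
  show "x * y * z = x * (y * z)"
    by (simp add: times_nil3_def algebra_simps)
  show "(x + y) * z = x * z + y * z" "x * (y + z) = x * y + x * z"
    by (simp_all add: times_nil3_def plus_nil3_def algebra_simps)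
qed

end

definition nil3_scale :: "'k::field \<Rightarrow> 'k nil3 \<Rightarrow> 'k nil3" where
  "nil3_scale r x =
    Nil3 (r * c_a x) (r * c_b x) (r * c_aa x) (r * c_ab x) (r * c_ba x) (r * c_bb x) (r * c_aab
      x) (r * c_aba x) (r * c_abb x) (r * c_bab x) (r * c_aaba x) (r * c_aabb x) (r * c_abab x)
      (r * c_aabab x)"

interpretation nil3: bilinear_algebra "nil3_scale :: 'k::field \<Rightarrow> 'k nil3 \<Rightarrow> 'k nil3" "(*)"
  by unfold_locales
     (simp_all add: nil3_scale_def times_nil3_def plus_nil3_def algebra_simps)

lemma nil3_first_type:
  fixes x y z :: "'k::field nil3"
  shows "x*y*z + y*x*z + x*z*y + z*x*y + y*z*x + z*y*x = 0"
  by (simp add: times_nil3_def plus_nil3_def zero_nil3_def algebra_simps)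

definition nil3_a :: "'k::field nil3" where "nil3_a = Nil3 1 0 0 0 0 0 0 0 0 0 0 0 0 0"

definition nil3_b :: "'k::field nil3" where "nil3_b = Nil3 0 1 0 0 0 0 0 0 0 0 0 0 0 0"

lemma nil3_generated:
  "x = nil3_scale (c_a x) (nil3_a)
     + nil3_scale (c_b x) (nil3_b)
     + nil3_scale (c_aa x) (nil3_a * nil3_a)
     + nil3_scale (c_ab x) (nil3_a * nil3_b)
     + nil3_scale (c_ba x) (nil3_b * nil3_a)
     + nil3_scale (c_bb x) (nil3_b * nil3_b)
     + nil3_scale (c_aab x) (nil3_a * nil3_a * nil3_b)
     + nil3_scale (c_aba x) (nil3_a * nil3_b * nil3_a)
     + nil3_scale (c_abb x) (nil3_a * nil3_b * nil3_b)
     + nil3_scale (c_bab x) (nil3_b * nil3_a * nil3_b)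
     + nil3_scale (c_aaba x) (nil3_a * nil3_a * nil3_b * nil3_a)
     + nil3_scale (c_aabb x) (nil3_a * nil3_a * nil3_b * nil3_b)
     + nil3_scale (c_abab x) (nil3_a * nil3_b * nil3_a * nil3_b)
     + nil3_scale (c_aabab x) (nil3_a * nil3_a * nil3_b * nil3_a * nil3_b)"
  by (simp add: nil3_a_def nil3_b_def times_nil3_def plus_nil3_def nil3_scale_def)

interpretation nil3_minus: bilinear_algebra
  "nil3_scale :: 'k::field \<Rightarrow> 'k nil3 \<Rightarrow> 'k nil3" commutator
proof
  fix c :: 'k and x y z :: "'k nil3"
  show "commutator (x + y) z = commutator x z + commutator y z"
    "commutator x (y + z) = commutator x y + commutator x z"
    by (simp_all add: commutator_def distrib_left distrib_right)
  show "commutator (nil3_scale c x) y = nil3_scale c (commutator x y)"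
    "commutator x (nil3_scale c y) = nil3_scale c (commutator x y)"
    by (simp_all only: commutator_def nil3.op_scale_left nil3.op_scale_right
        nil3.scale_right_diff_distrib)
qed

text \<open>Two distinct generators can be sent to \<open>a\<close> and \<open>b\<close>, which makes \<open>nil3\<close> a homomorphic image of the free
  algebra; identities pass to homomorphic images.\<close>

lemma is_identity_nil3:
  fixes f :: "('k::field, 'v) free_alg"
  assumes two: "\<exists>x y :: 'x. x \<noteq> y"
    and f: "is_identity (As1_scale :: 'k \<Rightarrow> ('k, 'x) As1 \<Rightarrow> ('k, 'x) As1) commutator f"
  shows "is_identity nil3_scale commutator f"
proof -
  obtain x y :: 'x where "x \<noteq> y" using two by blast
  obtain h :: "('k, 'x) As1 \<Rightarrow> 'k nil3" where
    h_add: "\<And>u v. h (u + v) = h u + h v" and h_scale: "\<And>c u. h (As1_scale c u) = nil3_scale c (h u)"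
    and h_mult: "\<And>u v. h (u * v) = h u * h v"
    and h_gen: "\<And>z. h (As1_gen z) = (if z = x then nil3_a else nil3_b)"
    using ex1_implies_ex[OF As1_universal[OF nil3.bilinear_algebra_axioms nil3_first_type,
        of "\<lambda>z. if z = x then nil3_a else nil3_b"]] by metis
  have h_zero: "h 0 = 0" using h_add[of 0 0] by simp
  have h_diff: "h (u - v) = h u - h v" for u v
    using h_add[of "u - v" v] by simp
  have h_sum: "h (sum p S) = (\<Sum>m\<in>S. h (p m))" for p :: "'v magma \<Rightarrow> ('k, 'x) As1" and S
    by (induction S rule: infinite_finite_induct) (simp_all add: h_add h_zero)
  have h_mon: "h (mon_eval commutator \<sigma> m) = mon_eval commutator (\<lambda>v. h (\<sigma> v)) m"
    for \<sigma> and m :: "'v magma"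
    by (induction m) (simp_all add: commutator_def h_diff h_mult)
  have h_eval: "h (eval As1_scale commutator \<sigma> f) = eval nil3_scale commutator (\<lambda>v. h (\<sigma> v)) f" for \<sigma>
    by (simp add: eval_def h_sum h_scale h_mon)
  have gens: "nil3_a \<in> range h" "nil3_b \<in> range h"
    using h_gen[of x] h_gen[of y] \<open>x \<noteq> y\<close> by (metis rangeI)+
  have closed: "u + v \<in> range h" "u * v \<in> range h" "nil3_scale c u \<in> range h"
    if "u \<in> range h" "v \<in> range h" for u v c
    using that by (auto simp flip: h_add h_mult h_scale)
  have "z \<in> range h" for z
    by (subst nil3_generated[of z]) (intro closed(1) closed(2) closed(3)[OF _ gens(1)] gens)
  then have surj: "h (inv h z) = z" for z by (rule f_inv_into_f)
  have "eval nil3_scale commutator \<tau> f = 0" for \<tau>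
    using h_eval[of "\<lambda>v. inv h (\<tau> v)"] f by (simp add: surj is_identity_def h_zero)
  then show ?thesis by (simp add: is_identity_def)
qed

section \<open>Coefficients from the coordinate of the longest word\<close>

lemma Lie_ideal_is_identity:
  assumes "f \<in> Lie_ideal"
  shows "is_identity (nil3_scale :: 'k::field \<Rightarrow> 'k nil3 \<Rightarrow> 'k nil3) commutator f"
proof (rule nil3_minus.follows_from_is_identity)
  show "follows_from f {anticomm_identity, jacobi_identity}"
    using assms by (simp add: follows_from_def Lie_ideal_def)
  show "is_identity nil3_scale commutator g"
    if "g \<in> {anticomm_identity, jacobi_identity}" for g :: "('k, nat) free_alg"
    using that
    by (auto simp: is_identity_def anticomm_identity_def jacobi_identity_def Let_def
        nil3_minus.eval_add nil3_minus.eval_diff nil3_minus.eval_uminus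
        nil3_minus.eval_fmult nil3_minus.eval_fvar commutator_def algebra_simps)
qed

text \<open>The arguments can always be chosen so that they contain three letters \<open>a\<close> and two letters \<open>b\<close> in
  total, and the coordinate of \<open>aabab\<close> then gives enough equations.\<close>

definition top_value :: "(nat \<Rightarrow> 'k::field nil3) \<Rightarrow> nat \<Rightarrow> nat list \<Rightarrow> 'k" where
  "top_value \<tau> w xs = c_aabab (foldl (\<lambda>u x. commutator u (\<tau> x)) (\<tau> w) xs)"

lemma c_aabab_eval_combination:
  "c_aabab (eval nil3_scale commutator \<tau> (\<Sum>xs\<in>S. fscale (c xs) (left_normed w xs)))
     = (\<Sum>xs\<in>S. c xs * top_value \<tau> w xs)"
proof -
  have foldl: "eval nil3_scale commutator \<tau> (foldl (\<lambda>f x. f \<odot> fvar x) g xs)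
      = foldl (\<lambda>u x. commutator u (\<tau> x)) (eval nil3_scale commutator \<tau> g) xs"
    for g :: "('a, nat) free_alg" and xs
    by (induction xs arbitrary: g) (simp_all add: nil3_minus.eval_fmult nil3_minus.eval_fvar)
  have sum: "c_aabab (sum F S) = (\<Sum>xs\<in>S. c_aabab (F xs))" for F :: "nat list \<Rightarrow> 'a nil3"
    by (induction S rule: infinite_finite_induct) (simp_all add: plus_nil3_def zero_nil3_def)
  show ?thesis
    by (simp add: nil3_minus.eval_sum nil3_minus.eval_fscale left_normed_def foldl
        nil3_minus.eval_fvar sum top_value_def nil3_scale_def)
qed

text \<open>Elements of the ideal vanish in \<open>nil3\<close>, so the combination of left-normed monomials to which a part
  of an identity is congruent vanishes there as well. This gives linear equations for its
  coefficients.\<close>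

lemma part_identity_combination:
  fixes f :: "('k::field_char_0, nat) free_alg"
  assumes "is_identity nil3_scale commutator f"
  shows "\<exists>c. part (\<lambda>m. leaves m = add_mset w M) f
      - (\<Sum>xs\<in>permutations_of_multiset M. fscale (c xs) (left_normed w xs)) \<in> Lie_ideal
    \<and> (\<forall>\<tau>. (\<Sum>xs\<in>permutations_of_multiset M. c xs * top_value \<tau> w xs) = 0)"
proof -
  let ?g = "part (\<lambda>m. leaves m = add_mset w M) f"
  have g: "is_identity nil3_scale commutator ?g"
    by (rule is_identity_part_leaves[OF nil3_minus.bilinear_algebra_axioms assms])
  obtain c where
    c: "?g - (\<Sum>xs\<in>permutations_of_multiset M. fscale (c xs) (left_normed w xs)) \<in> Lie_ideal"
    using left_normed_span_combination[OF part_in_left_normed_span] by blast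
  have "(\<Sum>xs\<in>permutations_of_multiset M. c xs * top_value \<tau> w xs) = 0" for \<tau>
    using Lie_ideal_is_identity[OF c] g
    by (simp add: is_identity_def nil3_minus.eval_diff flip: c_aabab_eval_combination)
      (simp add: zero_nil3_def)
  with c show ?thesis by blast
qed

lemma top_value_simps:
  "top_value \<tau> w [] = c_aabab (\<tau> w)"
  "top_value \<tau> w [x] = c_aabab (commutator (\<tau> w) (\<tau> x))"
  "top_value \<tau> w [x, y] = c_aabab (commutator (commutator (\<tau> w) (\<tau> x)) (\<tau> y))"
  "top_value \<tau> w [x, y, z]
    = c_aabab (commutator (commutator (commutator (\<tau> w) (\<tau> x)) (\<tau> y)) (\<tau> z))"
  by (simp_all add: top_value_def)

lemmas nil3_simps = nil3_a_def nil3_b_def commutator_def times_nil3_def plus_nil3_def minus_nil3_def zero_nil3_def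

abbreviation top2 :: "'k::field nil3 \<Rightarrow> 'k nil3 \<Rightarrow> 'k" where
  "top2 p q \<equiv> c_aabab (commutator p q)"

abbreviation top3 :: "'k::field nil3 \<Rightarrow> 'k nil3 \<Rightarrow> 'k nil3 \<Rightarrow> 'k" where
  "top3 p q r \<equiv> c_aabab (commutator (commutator p q) r)"

abbreviation top4 :: "'k::field nil3 \<Rightarrow> 'k nil3 \<Rightarrow> 'k nil3 \<Rightarrow> 'k nil3 \<Rightarrow> 'k" where
  "top4 p q r s \<equiv> c_aabab (commutator (commutator (commutator p q) r) s)"

text \<open>The arguments \<open>a, a, a, bb\<close> see only the component \<open>(3,1)\<close> of the Lie polynomials of degree \<open>4\<close>,
  because three of them are equal; a commutator survives only if it begins with \<open>bb\<close> and one \<open>a\<close>, which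
  gives the three equations with factor \<open>6\<close>. The component \<open>(2,1,1)\<close> needs arguments that span
  three dimensions, such as \<open>a, a, b, ab\<close>.\<close>

lemma top4_independent:
  fixes c1 :: "'k::field_char_0"
  assumes eq: "\<And>p q r s. c1 * top4 p q r s + c2 * top4 p q s r + c3 * top4 p r q s
      + c4 * top4 p r s q + c5 * top4 p s q r + c6 * top4 p s r q = 0"
  shows "c1 = 0 \<and> c2 = 0 \<and> c3 = 0 \<and> c4 = 0 \<and> c5 = 0 \<and> c6 = 0"
proof -
  have "6 * (c1 + c2) = 0" using eq[of nil3_a "nil3_b * nil3_b" nil3_a nil3_a]
    by (simp add: nil3_simps algebra_simps)
  moreover have "6 * (c3 + c4) = 0" using eq[of nil3_a nil3_a "nil3_b * nil3_b" nil3_a]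
    by (simp add: nil3_simps algebra_simps)
  moreover have "6 * (c5 + c6) = 0" using eq[of nil3_a nil3_a nil3_a "nil3_b * nil3_b"]
    by (simp add: nil3_simps algebra_simps)
  moreover have "- 3 * (c1 + c5) = 0" using eq[of nil3_a nil3_b nil3_a "nil3_a * nil3_b"]
    by (simp add: nil3_simps algebra_simps)
  moreover have "- 3 * (c2 + c3) = 0" using eq[of nil3_a nil3_b "nil3_a * nil3_b" nil3_a]
    by (simp add: nil3_simps algebra_simps)
  moreover have "- 3 * (c4 + c5) = 0" using eq[of nil3_a nil3_a "nil3_a * nil3_b" nil3_b]
    by (simp add: nil3_simps algebra_simps)
  ultimately have eqs: "c2 = - c1" "c4 = - c3" "c6 = - c5" "c5 = - c1" "c3 = - c2" "c5 = - c4"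
    by (simp_all add: add_eq_0_iff)
  then have "c1 = - c1" by simp
  then show ?thesis using eqs by simp
qed

text \<open>The case of two equal variables: they receive equal values, which excludes some of the
  substitutions above, but monomials coincide and only three coefficients remain.\<close>

lemma top4_independent_double:
  fixes c1 :: "'k::field_char_0"
  assumes eq: "\<And>p q r. c1 * top4 p q q r + c2 * top4 p q r q + c3 * top4 p r q q = 0"
  shows "c1 = 0 \<and> c2 = 0 \<and> c3 = 0"
proof -
  have 3: "c3 = 0" using eq[of nil3_a nil3_a "nil3_b * nil3_b"]
    by (simp add: nil3_simps)
  then have 1: "c1 = 0" using eq[of nil3_b nil3_a "nil3_a * nil3_b"]
    by (simp add: nil3_simps)
  have "c2 = 0" using 1 3 eq[of "nil3_b * nil3_b" nil3_a nil3_a]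
    by (simp add: nil3_simps)
  with 1 3 show ?thesis by simp
qed

lemma top3_independent:
  fixes c1 :: "'k::field_char_0"
  assumes eq: "\<And>p q r. c1 * top3 p q r + c2 * top3 p r q = 0"
  shows "c1 = 0 \<and> c2 = 0"
proof
  show "c1 = 0" using eq[of nil3_a nil3_b "nil3_a * nil3_a * nil3_b"]
    by (simp add: nil3_simps)
  show "c2 = 0" using eq[of nil3_a nil3_a "nil3_a * nil3_b * nil3_b"]
    by (simp add: nil3_simps)
qed

lemma top_values:
  "c_aabab (nil3_a * nil3_a * nil3_b * nil3_a * nil3_b) = (1 :: 'k::field_char_0)"
  "top2 (nil3_a * nil3_b) (nil3_a * nil3_a * nil3_b) = (- 2 :: 'k)"
  "top3 (nil3_a * nil3_b * nil3_b) nil3_a nil3_a = (3 :: 'k)"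
  "top4 (nil3_b * nil3_b) nil3_a nil3_a nil3_a = (- 6 :: 'k)"
  "top4 nil3_a nil3_a (nil3_b + nil3_a * nil3_b) (nil3_b + nil3_a * nil3_b) = (0 :: 'k)"
  "top4 nil3_a (nil3_b + nil3_a * nil3_b) nil3_a (nil3_b + nil3_a * nil3_b) = (- 3 :: 'k)"
  "top4 nil3_a (nil3_b + nil3_a * nil3_b) (nil3_b + nil3_a * nil3_b) nil3_a = (- 3 :: 'k)"
  by (simp_all add: nil3_simps)

section \<open>Multihomogeneous identities of degree at most four\<close>

lemma permutations_of_multiset_three:
  "permutations_of_multiset {#x, y, z#}
    = {[x, y, z], [x, z, y], [y, x, z], [y, z, x], [z, x, y], [z, y, x]}"
proof -
  have "permutations_of_multiset {#x, y, z#}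
      = (\<Union>v\<in>{x, y, z}. (#) v ` permutations_of_multiset ({#x, y, z#} - {#v#}))"
    by (subst permutations_of_multiset_nonempty) auto
  also have "\<dots> = {[x, y, z], [x, z, y], [y, x, z], [y, z, x], [z, x, y], [z, y, x]}"
    using permutations_of_multiset_doubleton[of y z] permutations_of_multiset_doubleton[of x z]
      permutations_of_multiset_doubleton[of x y]
    by (simp add: add_mset_commute insert_commute)
  finally show ?thesis .
qed

lemma permutations_of_multiset_three_double:
  "permutations_of_multiset {#x, x, y#} = {[x, x, y], [x, y, x], [y, x, x]}"
  unfolding permutations_of_multiset_three by blast

lemma permutations_of_multiset_three_equal:
  "permutations_of_multiset {#x, x, x#} = {[x, x, x]}"
  unfolding permutations_of_multiset_three by blast

lemma Lie_ideal_of_diff: "f - g \<in> Lie_ideal \<Longrightarrow> g \<in> Lie_ideal \<Longrightarrow> f \<in> Lie_ideal"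
  using Lie_ideal_add[of "f - g" g] by simp

context
  fixes f :: "('k::field_char_0, nat) free_alg"
  assumes f: "is_identity nil3_scale commutator f"
begin

lemma part_1: "part (\<lambda>m. leaves m = {#w#}) f \<in> Lie_ideal"
proof -
  let ?P = "permutations_of_multiset {#}"
  obtain c where c: "part (\<lambda>m. leaves m = {#w#}) f
      - (\<Sum>xs\<in>?P. fscale (c xs) (left_normed w xs)) \<in> Lie_ideal"
    and zero: "\<And>\<tau>. (\<Sum>xs\<in>?P. c xs * top_value \<tau> w xs) = 0"
    using part_identity_combination[OF f, of w "{#}"] by blast
  have "c [] = 0"
    using zero[of "\<lambda>_. nil3_a * nil3_a * nil3_b * nil3_a * nil3_b"]
    by (simp add: top_value_simps top_values)
  then show ?thesis using c by simp
qed

text \<open>In one variable there is nothing to evaluate: the monomials begin with \<open>[w, w]\<close>.\<close>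

lemma part_pure:
  assumes "M \<noteq> {#}" "set_mset M \<subseteq> {w}"
  shows "part (\<lambda>m. leaves m = add_mset w M) f \<in> Lie_ideal"
proof -
  obtain c where c: "part (\<lambda>m. leaves m = add_mset w M) f
      - (\<Sum>xs\<in>permutations_of_multiset M. fscale (c xs) (left_normed w xs)) \<in> Lie_ideal"
    using part_identity_combination[OF f, of w M] by blast
  have "left_normed w xs \<in> (Lie_ideal :: ('k, nat) free_alg set)"
    if "xs \<in> permutations_of_multiset M" for xs
    using that assms by (cases xs) (auto simp: permutations_of_multiset_def left_normed_self_in_Lie_ideal)
  then show ?thesis
    by (intro Lie_ideal_of_diff[OF c] Lie_ideal_sum Lie_ideal_scale)
qed

lemma part_11:
  assumes "w \<noteq> x"
  shows "part (\<lambda>m. leaves m = {#w, x#}) f \<in> Lie_ideal"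
proof -
  let ?P = "permutations_of_multiset {#x#}"
  obtain c where c: "part (\<lambda>m. leaves m = {#w, x#}) f
      - (\<Sum>xs\<in>?P. fscale (c xs) (left_normed w xs)) \<in> Lie_ideal"
    and zero: "\<And>\<tau>. (\<Sum>xs\<in>?P. c xs * top_value \<tau> w xs) = 0"
    using part_identity_combination[OF f, of w "{#x#}"] by blast
  have "c [x] = 0"
    using assms zero[of "(\<lambda>_. nil3_a * nil3_a * nil3_b)(w := nil3_a * nil3_b)"]
    by (simp add: top_value_simps top_values)
  then show ?thesis using c by simp
qed

lemma part_111:
  assumes "distinct [w, x, y]"
  shows "part (\<lambda>m. leaves m = {#w, x, y#}) f \<in> Lie_ideal"
proof -
  let ?P = "permutations_of_multiset {#x, y#}"
  obtain c where c: "part (\<lambda>m. leaves m = {#w, x, y#}) f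
      - (\<Sum>xs\<in>?P. fscale (c xs) (left_normed w xs)) \<in> Lie_ideal"
    and zero: "\<And>\<tau>. (\<Sum>xs\<in>?P. c xs * top_value \<tau> w xs) = 0"
    using part_identity_combination[OF f, of w "{#x, y#}"] by blast
  have "c [x, y] * top3 p q r + c [y, x] * top3 p r q = 0" for p q r
    using assms zero[of "(\<lambda>_. 0)(w := p, x := q, y := r)"]
    by (simp add: permutations_of_multiset_doubleton top_value_simps)
  from top3_independent[OF this] show ?thesis
    using c assms by (simp add: permutations_of_multiset_doubleton)
qed

text \<open>Starting with the variable that occurs once leaves a single left-normed monomial.\<close>

lemma part_12:
  assumes "w \<noteq> x"
  shows "part (\<lambda>m. leaves m = {#w, x, x#}) f \<in> Lie_ideal"
proof -
  let ?P = "permutations_of_multiset {#x, x#}"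
  obtain c where c: "part (\<lambda>m. leaves m = {#w, x, x#}) f
      - (\<Sum>xs\<in>?P. fscale (c xs) (left_normed w xs)) \<in> Lie_ideal"
    and zero: "\<And>\<tau>. (\<Sum>xs\<in>?P. c xs * top_value \<tau> w xs) = 0"
    using part_identity_combination[OF f, of w "{#x, x#}"] by blast
  have "c [x, x] = 0"
    using assms zero[of "(\<lambda>_. nil3_a)(w := nil3_a * nil3_b * nil3_b)"]
    by (simp add: top_value_simps top_values permutations_of_multiset_doubleton)
  then show ?thesis using c by (simp add: permutations_of_multiset_doubleton)
qed

lemma part_1111:
  assumes "distinct [w, x, y, z]"
  shows "part (\<lambda>m. leaves m = {#w, x, y, z#}) f \<in> Lie_ideal"
proof -
  let ?P = "permutations_of_multiset {#x, y, z#}"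
  obtain c where c: "part (\<lambda>m. leaves m = {#w, x, y, z#}) f
      - (\<Sum>xs\<in>?P. fscale (c xs) (left_normed w xs)) \<in> Lie_ideal"
    and zero: "\<And>\<tau>. (\<Sum>xs\<in>?P. c xs * top_value \<tau> w xs) = 0"
    using part_identity_combination[OF f, of w "{#x, y, z#}"] by blast
  have "c [x, y, z] * top4 p q r s + c [x, z, y] * top4 p q s r + c [y, x, z] * top4 p r q s
      + c [y, z, x] * top4 p r s q + c [z, x, y] * top4 p s q r + c [z, y, x] * top4 p s r q = 0"
    for p q r s
    using assms zero[of "(\<lambda>_. 0)(w := p, x := q, y := r, z := s)"]
    by (simp add: permutations_of_multiset_three top_value_simps add.assoc)
  from top4_independent[OF this] show ?thesis
    using c assms by (simp add: permutations_of_multiset_three)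
qed

lemma part_112:
  assumes "distinct [w, x, y]"
  shows "part (\<lambda>m. leaves m = {#w, x, x, y#}) f \<in> Lie_ideal"
proof -
  let ?P = "permutations_of_multiset {#x, x, y#}"
  obtain c where c: "part (\<lambda>m. leaves m = {#w, x, x, y#}) f
      - (\<Sum>xs\<in>?P. fscale (c xs) (left_normed w xs)) \<in> Lie_ideal"
    and zero: "\<And>\<tau>. (\<Sum>xs\<in>?P. c xs * top_value \<tau> w xs) = 0"
    using part_identity_combination[OF f, of w "{#x, x, y#}"] by blast
  have "c [x, x, y] * top4 p q q r + c [x, y, x] * top4 p q r q + c [y, x, x] * top4 p r q q = 0"
    for p q r
    using assms zero[of "(\<lambda>_. 0)(w := p, x := q, y := r)"]
    by (simp add: permutations_of_multiset_three_double top_value_simps add.assoc)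
  from top4_independent_double[OF this] show ?thesis
    using c assms by (simp add: permutations_of_multiset_three_double)
qed

text \<open>Of the three left-normed monomials, one begins with \<open>[w, w]\<close> and the other two are congruent, so a
  single equation is needed.\<close>

lemma part_22:
  assumes "w \<noteq> x"
  shows "part (\<lambda>m. leaves m = {#w, x, x, w#}) f \<in> Lie_ideal"
proof -
  let ?P = "permutations_of_multiset {#x, x, w#}"
  let ?L = "left_normed w :: nat list \<Rightarrow> ('k, nat) free_alg"
  obtain c where c: "part (\<lambda>m. leaves m = {#w, x, x, w#}) f
      - (\<Sum>xs\<in>?P. fscale (c xs) (?L xs)) \<in> Lie_ideal"
    and zero: "\<And>\<tau>. (\<Sum>xs\<in>?P. c xs * top_value \<tau> w xs) = 0"
    using part_identity_combination[OF f, of w "{#x, x, w#}"] by blast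
  \<comment> \<open>No words \<open>p, q\<close> have \<open>p, p, q, q\<close> of total content \<open>aaabb\<close>; in the sum \<open>b + ab\<close> the two
    occurrences of \<open>x\<close> contribute one \<open>b\<close> and one \<open>ab\<close>.\<close>
  have "(- 3) * (c [x, x, w] + c [x, w, x]) = 0"
    using assms zero[of "(\<lambda>_. nil3_b + nil3_a * nil3_b)(w := nil3_a)"]
    by (simp add: permutations_of_multiset_three_double top_value_simps top_values algebra_simps)
  then have "c [x, w, x] = - c [x, x, w]" by (simp add: add_eq_0_iff)
  then have "(\<Sum>xs\<in>?P. fscale (c xs) (?L xs))
      = fscale (- c [x, x, w]) (?L [x, w, x] - ?L [x, x, w]) + fscale (c [w, x, x]) (?L [w, x, x])"
    using assms by (simp add: permutations_of_multiset_three_double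
        free_alg.scale_right_diff_distrib free_alg.scale_minus_left)
  also have "\<dots> \<in> Lie_ideal"
    by (intro Lie_ideal_add Lie_ideal_scale left_normed_swap_last left_normed_self_in_Lie_ideal)
  finally show ?thesis by (rule Lie_ideal_of_diff[OF c])
qed

lemma part_13:
  assumes "w \<noteq> x"
  shows "part (\<lambda>m. leaves m = {#w, x, x, x#}) f \<in> Lie_ideal"
proof -
  let ?P = "permutations_of_multiset {#x, x, x#}"
  obtain c where c: "part (\<lambda>m. leaves m = {#w, x, x, x#}) f
      - (\<Sum>xs\<in>?P. fscale (c xs) (left_normed w xs)) \<in> Lie_ideal"
    and zero: "\<And>\<tau>. (\<Sum>xs\<in>?P. c xs * top_value \<tau> w xs) = 0"
    using part_identity_combination[OF f, of w "{#x, x, x#}"] by blast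
  have "c [x, x, x] = 0"
    using assms zero[of "(\<lambda>_. nil3_a)(w := nil3_b * nil3_b)"]
    by (simp add: top_value_simps top_values permutations_of_multiset_three_equal)
  then show ?thesis using c by (simp add: permutations_of_multiset_three_equal)
qed

lemma part_size_3: "part (\<lambda>m. leaves m = {#x, y, z#}) f \<in> Lie_ideal"
proof (cases "distinct [x, y, z]")
  case True
  then show ?thesis by (rule part_111)
next
  case False
  then consider "x = y" | "x = z" | "y = z" by auto
  then obtain a b where ab: "{#x, y, z#} = {#b, a, a#}"
    by cases (metis add_mset_commute)+
  show ?thesis
    unfolding ab by (cases "a = b") (auto intro: part_pure part_12)
qed

lemma part_size_4: "part (\<lambda>m. leaves m = {#w, x, y, z#}) f \<in> Lie_ideal"
proof (cases "distinct [w, x, y, z]")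
  case True
  then show ?thesis by (rule part_1111)
next
  case False
  then consider "w = x" | "w = y" | "w = z" | "x = y" | "x = z" | "y = z" by auto
  then obtain a b c where abc: "{#w, x, y, z#} = {#b, a, a, c#}"
    by cases (metis add_mset_commute)+
  consider "b = a" "c = a" | "b = a" "c \<noteq> a" | "b \<noteq> a" "c = a" | "b \<noteq> a" "c = b" | "distinct [b, a, c]"
    by auto
  then show ?thesis
  proof cases
    case 2
    then have "{#w, x, y, z#} = {#c, a, a, a#}" using abc by (simp add: add_mset_commute)
    then show ?thesis using part_13[of c a] 2 by simp
  qed (auto simp: abc intro: part_pure part_13 part_22 part_112)
qed

lemma part_in_Lie_ideal:
  assumes "N \<noteq> {#}" "size N \<le> 4"
  shows "part (\<lambda>m. leaves m = N) f \<in> Lie_ideal"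
proof -
  obtain xs where N: "N = mset xs" by (metis ex_mset)
  with assms have "xs \<noteq> []" "length xs \<le> 4" by auto
  then consider x where "xs = [x]" | x y where "xs = [x, y]" | x y z where "xs = [x, y, z]"
    | w x y z where "xs = [w, x, y, z]"
    by (auto simp: le_Suc_eq length_Suc_conv numeral_eq_Suc)
  then show ?thesis
  proof cases
    case (2 x y)
    then show ?thesis unfolding N by (cases "x = y") (auto intro: part_pure part_11)
  qed (simp_all add: N part_1 part_size_3 part_size_4)
qed

end

theorem theorem1:
  fixes f :: "('k::field_char_0, nat) free_alg"
  assumes "\<exists>x y :: 'x. x \<noteq> y"
    and "is_identity (As1_scale :: 'k \<Rightarrow> ('k, 'x) As1 \<Rightarrow> ('k, 'x) As1) commutator f"
    and "degree_le 4 f"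
  shows "follows_from f {anticomm_identity, jacobi_identity}"
proof -
  have f: "is_identity nil3_scale commutator f"
    by (rule is_identity_nil3[OF assms(1,2)])
  have "part (\<lambda>m. leaves m = N) f \<in> Lie_ideal" if "N \<in> leaves ` Poly_Mapping.keys f" for N
  proof (rule part_in_Lie_ideal[OF f])
    from that obtain m where m: "N = leaves m" "m \<in> Poly_Mapping.keys f" by blast
    show "N \<noteq> {#}" unfolding m(1) by (induction m) auto
    show "size N \<le> 4" using m assms(3) by (simp add: size_leaves degree_le_def)
  qed
  then have "(\<Sum>N\<in>leaves ` Poly_Mapping.keys f. part (\<lambda>m. leaves m = N) f) \<in> Lie_ideal"
    by (rule Lie_ideal_sum)
  then show ?thesis
    by (simp add: sum_part_leaves follows_from_def Lie_ideal_def)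
qed

end
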